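(* Let $k\ge 3$ and $3k-3\le n<k^2-k+1$ be integers. Let $G(n,k,1)$ be the graph with vertex set $\binom{[n]}{k}$ in which two $k$-sets $A,B$ are adjacent if and only if $|A\cap B|=1$. Then \[\vartheta(G(n,k,1))>\binom{n-2}{k-2}.\]
   Context: $\binom{[n]}{k}$ denotes the set of $k$-element subsets of $[n]=\{1,\dots,n\}$. For a graph $G=(V,E)$, the Lovász number is $\vartheta(G)=\min\{\mathrm{lev}(A)\}$, the minimum taken over all symmetric real $|V|\times|V|$ matrices $A$ with $a_{ij}=1$ whenever $\{i,j\}\notin E$ (including $i=j$), where $\mathrm{lev}(A)$ denotes the largest eigenvalue of $A$. *)

theory Defs
  imports Complex_Main "HOL-Library.Ramsey"
begin

text \<open>
  A real matrix indexed by a finite set \<open>V\<close> is a function \<open>'a \<Rightarrow> 'a \<Rightarrow> real\<close> of which only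
  the values on \<open>V \<times> V\<close> matter; likewise for vectors, which are required to be nonzero on \<open>V\<close>.
\<close>

definition eigenvalues_on :: "'a set \<Rightarrow> ('a \<Rightarrow> 'a \<Rightarrow> real) \<Rightarrow> real set" where
  "eigenvalues_on V A =
    {\<mu>. \<exists>x :: 'a \<Rightarrow> real. (\<exists>i\<in>V. x i \<noteq> 0) \<and> (\<forall>i\<in>V. (\<Sum>j\<in>V. A i j * x j) = \<mu> * x i)}"

definition symmetric_on :: "'a set \<Rightarrow> ('a \<Rightarrow> 'a \<Rightarrow> real) \<Rightarrow> bool" where
  "symmetric_on V A \<longleftrightarrow> (\<forall>i\<in>V. \<forall>j\<in>V. A i j = A j i)"

definition lev :: "'a set \<Rightarrow> ('a \<Rightarrow> 'a \<Rightarrow> real) \<Rightarrow> real" where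
  "lev V A = Max (eigenvalues_on V A)"

text \<open>
  A simple graph is given by its vertex set \<open>V\<close> and its set \<open>E\<close> of two-element edges, so the
  diagonal condition \<open>A i i = 1\<close> is the case \<open>i = j\<close> below, \<open>{i, i}\<close> not being an edge.
  For finite nonempty \<open>V\<close> the infimum is a minimum: the all-ones matrix is admissible, an
  admissible matrix has trace \<open>card V\<close> and hence largest eigenvalue at least 1, and those with
  largest eigenvalue below a given bound form a compact set.
\<close>

definition lovasz_number :: "'a set \<Rightarrow> 'a set set \<Rightarrow> real" where
  "lovasz_number V E =
    (INF A \<in> {A. symmetric_on V A \<and> (\<forall>i\<in>V. \<forall>j\<in>V. {i, j} \<notin> E \<longrightarrow> A i j = 1)}. lev V A)"

text \<open>The graph \<open>G(n,k,l)\<close>; the vertex set is \<open>nsets {1..n} k\<close>.\<close>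

definition G_verts :: "nat \<Rightarrow> nat \<Rightarrow> nat set set" where
  "G_verts n k = [{1..n}]\<^bsup>k\<^esup>"

definition G_edges :: "nat \<Rightarrow> nat \<Rightarrow> nat \<Rightarrow> nat set set set" where
  "G_edges n k l =
    {{A, B} | A B. A \<in> G_verts n k \<and> B \<in> G_verts n k \<and> A \<noteq> B \<and> card (A \<inter> B) = l}"

end

theory Submission
  imports Defs "HOL-Analysis.Function_Topology"
begin

text \<open>
  The matrix \<open>B X Y = card (X \<inter> Y) - 1\<close> vanishes on the edges, and for \<open>n < k\<^sup>2\<close> it is positive
  semidefinite: it is the Gram matrix of the centred indicator vectors \<open>[p \<in> X] - k / n\<close> plus
  \<open>k\<^sup>2 / n - 1\<close> times the all-ones matrix. By weak duality the Lovasz number is at least the sum of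
  all entries of \<open>B\<close> divided by its trace, that is at least
  \<open>(n choose k) * (k\<^sup>2 - n) / (n * (k - 1))\<close>. This exceeds \<open>(n - 2) choose (k - 2)\<close> exactly when
  \<open>(n - k) * (k\<^sup>2 - k + 1 - n) > 0\<close>.
\<close>

section \<open>The largest eigenvalue as a maximal Rayleigh quotient\<close>

text \<open>\<open>lev\<close> is a \<open>Max\<close>, which bounds its set only when the set is
  finite. Eigenvectors for distinct eigenvalues of a symmetric matrix are orthogonal, and Bessel's
  inequality allows at most \<open>card V\<close> of them.\<close>

lemma finite_eigenvalues_on:
  assumes "finite V" and sym: "symmetric_on V A"
  shows "finite (eigenvalues_on V A)"
proof (rule ccontr)
  assume "infinite (eigenvalues_on V A)"
  then obtain S where S: "S \<subseteq> eigenvalues_on V A" "finite S" "card S = Suc (card V)"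
    using infinite_arbitrarily_large by blast
  have "\<forall>\<mu>\<in>S. \<exists>x. (\<exists>i\<in>V. x i \<noteq> 0) \<and> (\<forall>i\<in>V. (\<Sum>j\<in>V. A i j * x j) = \<mu> * x i)"
    using S(1) by (auto simp: eigenvalues_on_def)
  then obtain x where nz: "\<And>\<mu>. \<mu> \<in> S \<Longrightarrow> \<exists>i\<in>V. x \<mu> i \<noteq> 0"
    and eig: "\<And>\<mu> i. \<mu> \<in> S \<Longrightarrow> i \<in> V \<Longrightarrow> (\<Sum>j\<in>V. A i j * x \<mu> j) = \<mu> * x \<mu> i"
    by metis
  have orth: "(\<Sum>i\<in>V. x \<mu> i * x \<nu> i) = 0" if "\<mu> \<in> S" "\<nu> \<in> S" "\<mu> \<noteq> \<nu>" for \<mu> \<nu>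
  proof -
    have "\<mu> * (\<Sum>i\<in>V. x \<mu> i * x \<nu> i) = (\<Sum>i\<in>V. (\<Sum>j\<in>V. A i j * x \<mu> j) * x \<nu> i)"
      using eig[OF that(1)] by (simp add: sum_distrib_left mult.assoc)
    also have "\<dots> = (\<Sum>i\<in>V. \<Sum>j\<in>V. A i j * x \<mu> j * x \<nu> i)"
      by (simp add: sum_distrib_right)
    also have "\<dots> = (\<Sum>j\<in>V. \<Sum>i\<in>V. A i j * x \<mu> j * x \<nu> i)"
      by (rule sum.swap)
    also have "\<dots> = (\<Sum>j\<in>V. \<Sum>i\<in>V. x \<mu> j * (A j i * x \<nu> i))"
      using sym by (intro sum.cong refl) (auto simp: symmetric_on_def)
    also have "\<dots> = (\<Sum>j\<in>V. x \<mu> j * (\<nu> * x \<nu> j))"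
      using eig[OF that(2)] by (simp flip: sum_distrib_left)
    also have "\<dots> = \<nu> * (\<Sum>i\<in>V. x \<mu> i * x \<nu> i)"
      by (simp add: sum_distrib_left mult_ac)
    finally show ?thesis using that(3) by simp
  qed
  define q where "q = (\<lambda>\<mu>. \<Sum>i\<in>V. (x \<mu> i)\<^sup>2)"
  have q_pos: "q \<mu> > 0" if \<mu>: "\<mu> \<in> S" for \<mu>
  proof -
    obtain i where "i \<in> V" "x \<mu> i \<noteq> 0" using nz[OF \<mu>] by blast
    then show ?thesis unfolding q_def using assms(1) by (intro sum_pos2[of V i]) auto
  qed
  have bessel: "(\<Sum>\<mu>\<in>S. (x \<mu> i)\<^sup>2 / q \<mu>) \<le> 1" if i: "i \<in> V" for i
  proof -
    \<comment> \<open>\<open>w\<close> is the orthogonal projection of the unit vector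
      \<open>e\<close> at \<open>i\<close> onto the span of the eigenvectors. Both its inner product
      with \<open>e\<close> and its squared norm equal the sum to be bounded, so expanding the
      squared distance from \<open>e\<close> to \<open>w\<close> gives the bound.\<close>
    define c where "c = (\<lambda>\<mu>. x \<mu> i / q \<mu>)"
    define e where "e = (\<lambda>j. if j = i then 1 else 0 :: real)"
    define w where "w = (\<lambda>j. \<Sum>\<mu>\<in>S. c \<mu> * x \<mu> j)"
    have "(\<Sum>j\<in>V. e j * w j) = w i"
      using i assms(1) by (simp add: e_def sum.delta if_distrib[of "\<lambda>t. t * _"] cong: if_cong)
    also have "\<dots> = (\<Sum>\<mu>\<in>S. (x \<mu> i)\<^sup>2 / q \<mu>)"
      by (simp add: w_def c_def power2_eq_square)
    finally have ew: "(\<Sum>j\<in>V. e j * w j) = (\<Sum>\<mu>\<in>S. (x \<mu> i)\<^sup>2 / q \<mu>)" .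
    have ee: "(\<Sum>j\<in>V. (e j)\<^sup>2) = 1"
      using i assms(1) by (simp add: e_def sum.delta if_distrib[of "\<lambda>t. t ^ 2"] cong: if_cong)
    have "(\<Sum>j\<in>V. (w j)\<^sup>2) = (\<Sum>j\<in>V. \<Sum>\<mu>\<in>S. \<Sum>\<nu>\<in>S. (c \<mu> * x \<mu> j) * (c \<nu> * x \<nu> j))"
      by (simp add: w_def power2_eq_square sum_product)
    also have "\<dots> = (\<Sum>\<mu>\<in>S. \<Sum>j\<in>V. \<Sum>\<nu>\<in>S. (c \<mu> * x \<mu> j) * (c \<nu> * x \<nu> j))"
      by (rule sum.swap)
    also have "\<dots> = (\<Sum>\<mu>\<in>S. \<Sum>\<nu>\<in>S. \<Sum>j\<in>V. (c \<mu> * x \<mu> j) * (c \<nu> * x \<nu> j))"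
      by (intro sum.cong refl sum.swap)
    also have "\<dots> = (\<Sum>\<mu>\<in>S. \<Sum>\<nu>\<in>S. c \<mu> * c \<nu> * (\<Sum>j\<in>V. x \<mu> j * x \<nu> j))"
      by (simp add: sum_distrib_left mult_ac)
    also have "\<dots> = (\<Sum>\<mu>\<in>S. \<Sum>\<nu>\<in>S. if \<nu> = \<mu> then (c \<mu>)\<^sup>2 * q \<mu> else 0)"
      using orth by (intro sum.cong refl) (auto simp: q_def power2_eq_square)
    also have "\<dots> = (\<Sum>\<mu>\<in>S. (c \<mu>)\<^sup>2 * q \<mu>)"
      using S(2) by simp
    also have "\<dots> = (\<Sum>\<mu>\<in>S. (x \<mu> i)\<^sup>2 / q \<mu>)"
      using q_pos by (intro sum.cong refl) (auto simp: c_def power2_eq_square)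
    finally have ww: "(\<Sum>j\<in>V. (w j)\<^sup>2) = (\<Sum>\<mu>\<in>S. (x \<mu> i)\<^sup>2 / q \<mu>)" .
    have "0 \<le> (\<Sum>j\<in>V. (e j - w j)\<^sup>2)"
      by (simp add: sum_nonneg)
    also have "\<dots> = (\<Sum>j\<in>V. (e j)\<^sup>2) + (\<Sum>j\<in>V. (w j)\<^sup>2) - 2 * (\<Sum>j\<in>V. e j * w j)"
      by (simp add: power2_diff sum.distrib sum_subtractf sum_distrib_left mult.assoc)
    finally show ?thesis using ee ew ww by simp
  qed
  \<comment> \<open>Summed over all \<open>i\<close>, the Bessel terms of each eigenvector add up to
    1, so \<open>card S\<close> would be at most \<open>card V\<close>.\<close>
  have "real (card S) = (\<Sum>\<mu>\<in>S. q \<mu> / q \<mu>)"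
    using q_pos by (simp add: less_imp_neq[symmetric])
  also have "\<dots> = (\<Sum>\<mu>\<in>S. \<Sum>i\<in>V. (x \<mu> i)\<^sup>2 / q \<mu>)"
    by (simp add: q_def flip: sum_divide_distrib)
  also have "\<dots> = (\<Sum>i\<in>V. \<Sum>\<mu>\<in>S. (x \<mu> i)\<^sup>2 / q \<mu>)"
    by (rule sum.swap)
  also have "\<dots> \<le> (\<Sum>i\<in>V. 1)"
    by (rule sum_mono) (rule bessel)
  finally show False using S(3) by simp
qed

text \<open>Vectors are functions on the whole type, so the coordinates off \<open>V\<close> are
  pinned to 0. The sphere is then a closed subset of a product of compact sets, and Tychonoff's
  theorem applies.\<close>

lemma compact_unit_sphere_on:
  fixes V :: "'a set"
  assumes "finite V"
  shows "compact {x :: 'a \<Rightarrow> real. (\<forall>i. i \<notin> V \<longrightarrow> x i = 0) \<and> (\<Sum>i\<in>V. (x i)\<^sup>2) = 1}"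
    (is "compact ?K")
proof -
  let ?B = "\<lambda>i. if i \<in> V then {-1..1} else {0 :: real}"
  have "compactin (product_topology (\<lambda>i. euclidean) UNIV) (PiE UNIV ?B)"
    by (auto simp: compactin_PiE)
  then have "compact (PiE UNIV ?B)"
    by (simp add: euclidean_product_topology flip: compactin_euclidean_iff)
  moreover have "closed {x :: 'a \<Rightarrow> real. (\<Sum>i\<in>V. (x i)\<^sup>2) = 1}"
    by (intro closed_Collect_eq continuous_intros continuous_on_product_coordinates)
  ultimately have "compact (PiE UNIV ?B \<inter> {x. (\<Sum>i\<in>V. (x i)\<^sup>2) = 1})"
    by (rule compact_Int_closed)
  moreover have "x i \<in> {-1..1}" if "i \<in> V" "(\<Sum>i\<in>V. (x i)\<^sup>2) = 1" for x :: "'a \<Rightarrow> real" and i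
  proof -
    have "(x i)\<^sup>2 \<le> 1"
      using member_le_sum[of i V "\<lambda>i. (x i)\<^sup>2"] that assms by simp
    then show ?thesis by (auto simp: abs_square_le_1 abs_le_iff)
  qed
  then have "PiE UNIV ?B \<inter> {x. (\<Sum>i\<in>V. (x i)\<^sup>2) = 1} = ?K"
    by (fastforce simp: PiE_def Pi_def split: if_splits)
  ultimately show ?thesis by simp
qed

text \<open>The quadratic form attains its maximum on the compact unit sphere, and first-order
  optimality there makes the maximiser an eigenvector. In particular, an eigenvalue exists.\<close>

lemma rayleigh_quotient_attained:
  assumes fin: "finite V" and "V \<noteq> {}" and sym: "symmetric_on V A"
  shows "\<exists>\<mu>\<in>eigenvalues_on V A.
    \<forall>y. (\<Sum>i\<in>V. \<Sum>j\<in>V. A i j * y i * y j) \<le> \<mu> * (\<Sum>i\<in>V. (y i)\<^sup>2)"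
proof -
  define Q where "Q = (\<lambda>y :: 'a \<Rightarrow> real. \<Sum>i\<in>V. \<Sum>j\<in>V. A i j * y i * y j)"
  define N where "N = (\<lambda>y :: 'a \<Rightarrow> real. \<Sum>i\<in>V. (y i)\<^sup>2)"
  define K where "K = {x :: 'a \<Rightarrow> real. (\<forall>i. i \<notin> V \<longrightarrow> x i = 0) \<and> N x = 1}"
  obtain a where a: "a \<in> V" using assms(2) by blast
  have "compact K"
    unfolding K_def N_def by (rule compact_unit_sphere_on[OF fin])
  moreover have "(\<lambda>i. if i = a then 1 else 0) \<in> K"
    using a fin by (auto simp: K_def N_def if_distrib[of "\<lambda>t. t ^ 2"] cong: if_cong)
  then have "K \<noteq> {}" by blast
  moreover have "continuous_on K Q"
    unfolding Q_def by (intro continuous_intros continuous_on_product_then_coordinatewise[OF continuous_on_id, unfolded id_def])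
  ultimately obtain x where x: "x \<in> K" and max: "\<And>y. y \<in> K \<Longrightarrow> Q y \<le> Q x"
    using continuous_attains_sup by metis
  have Nx: "N x = 1" using x by (simp add: K_def)
  define \<mu> where "\<mu> = Q x"
  have le: "Q y \<le> \<mu> * N y" for y
  proof (cases "N y = 0")
    case True
    then have "y i = 0" if "i \<in> V" for i
      using that fin by (auto simp: N_def sum_nonneg_eq_0_iff)
    then show ?thesis using True by (simp add: Q_def)
  next
    case False
    then have pos: "N y > 0" by (simp add: N_def sum_nonneg order_less_le)
    define z where "z = (\<lambda>i. if i \<in> V then y i / sqrt (N y) else 0)"
    have "N z = N y / (sqrt (N y))\<^sup>2"
      by (simp add: N_def z_def power_divide flip: sum_divide_distrib)
    then have "N z = 1" using pos by simp
    then have "z \<in> K" by (auto simp: K_def z_def)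
    then have "Q z \<le> \<mu>" unfolding \<mu>_def by (rule max)
    moreover have "Q z = Q y / (sqrt (N y) * sqrt (N y))"
      by (simp add: Q_def z_def sum_divide_distrib)
    ultimately show ?thesis using pos by (simp add: divide_le_eq)
  qed
  have "(\<Sum>j\<in>V. A i j * x j) = \<mu> * x i" if i: "i \<in> V" for i
  proof -
    define b where "b = (\<Sum>j\<in>V. A i j * x j) - \<mu> * x i"
    define e where "e = (\<lambda>j. if j = i then 1 else 0 :: real)"
    have delta: "(\<Sum>j\<in>V. f j * e j) = f i" for f
      using i fin by (simp add: e_def if_distrib[of "\<lambda>t. _ * t"] cong: if_cong)
    \<comment> \<open>Perturb the maximiser \<open>x\<close> by \<open>t\<close> in direction
      \<open>i\<close>. The left side is \<open>Q - \<mu> * N\<close> at the perturbed point, and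
      its derivative at \<open>t = 0\<close> is \<open>2 * b\<close>. A quadratic in
      \<open>t\<close> without constant term that is never positive must have zero linear
      coefficient.\<close>
    have nonpos: "t * (2 * b) + t\<^sup>2 * (A i i - \<mu>) \<le> 0" for t
    proof -
      have "Q (\<lambda>j. x j + t * e j) = Q x + t * (\<Sum>k\<in>V. \<Sum>j\<in>V. A k j * x k * e j)
          + t * (\<Sum>k\<in>V. (\<Sum>j\<in>V. A k j * x j) * e k) + t\<^sup>2 * (\<Sum>k\<in>V. (\<Sum>j\<in>V. A k j * e j) * e k)"
        by (simp add: Q_def algebra_simps sum.distrib sum_distrib_left power2_eq_square)
      also have "\<dots> = Q x + t * (\<Sum>k\<in>V. A k i * x k) + t * (\<Sum>j\<in>V. A i j * x j) + t\<^sup>2 * A i i"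
        by (simp only: delta)
      also have "(\<Sum>k\<in>V. A k i * x k) = (\<Sum>k\<in>V. A i k * x k)"
        using sym i by (intro sum.cong) (auto simp: symmetric_on_def)
      finally have q: "Q (\<lambda>j. x j + t * e j) = Q x + 2 * t * (\<Sum>j\<in>V. A i j * x j) + t\<^sup>2 * A i i"
        by simp
      have "N (\<lambda>j. x j + t * e j) = N x + 2 * t * (\<Sum>j\<in>V. x j * e j) + t\<^sup>2 * (\<Sum>j\<in>V. e j * e j)"
        by (simp add: N_def algebra_simps sum.distrib sum_distrib_left power2_eq_square)
      also have "\<dots> = 1 + 2 * t * x i + t\<^sup>2"
        by (simp only: delta Nx) (simp add: e_def)
      finally have "N (\<lambda>j. x j + t * e j) = 1 + 2 * t * x i + t\<^sup>2" .
      with q le[of "\<lambda>j. x j + t * e j"] show ?thesis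
        by (simp add: b_def \<mu>_def algebra_simps)
    qed
    have "b = 0"
    proof (rule ccontr)
      assume "b \<noteq> 0"
      define s where "s = 1 + \<bar>A i i - \<mu>\<bar>"
      have s: "s > 0" "- (A i i - \<mu>) \<le> s" by (auto simp: s_def)
      \<comment> \<open>The choice \<open>t = b / s\<close> lets the linear term dominate.\<close>
      have "b / s * (2 * b) + (b / s)\<^sup>2 * (A i i - \<mu>) \<ge> b / s * (2 * b) - (b / s)\<^sup>2 * s"
        using mult_left_mono[OF s(2), of "(b / s)\<^sup>2"] by (simp add: algebra_simps)
      moreover have "b / s * (2 * b) - (b / s)\<^sup>2 * s = b\<^sup>2 / s"
        using s by (simp add: field_simps power2_eq_square)
      moreover have "b\<^sup>2 / s > 0" using s \<open>b \<noteq> 0\<close> by simp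
      ultimately show False using nonpos[of "b / s"] by linarith
    qed
    then show ?thesis by (simp add: b_def)
  qed
  moreover have "\<exists>i\<in>V. x i \<noteq> 0"
    using Nx by (auto simp: N_def intro: ccontr)
  ultimately have "\<mu> \<in> eigenvalues_on V A"
    by (auto simp: eigenvalues_on_def)
  then show ?thesis using le by (auto simp: Q_def N_def)
qed

lemma quadratic_form_le_lev:
  assumes "finite V" "V \<noteq> {}" "symmetric_on V A"
  shows "(\<Sum>i\<in>V. \<Sum>j\<in>V. A i j * y i * y j) \<le> lev V A * (\<Sum>i\<in>V. (y i)\<^sup>2)"
proof -
  obtain \<mu> where "\<mu> \<in> eigenvalues_on V A"
    and le: "(\<Sum>i\<in>V. \<Sum>j\<in>V. A i j * y i * y j) \<le> \<mu> * (\<Sum>i\<in>V. (y i)\<^sup>2)"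
    using rayleigh_quotient_attained[OF assms] by blast
  then have "\<mu> \<le> lev V A"
    using finite_eigenvalues_on[OF assms(1,3)] by (simp add: lev_def)
  then show ?thesis
    using le by (meson mult_right_mono order_trans sum_nonneg zero_le_power2)
qed

section \<open>Weak duality\<close>

text \<open>A Gram matrix is a sum of rank-one matrices, one for each \<open>p\<close>. Pairing
  \<open>A\<close> with one of these evaluates the quadratic form of \<open>A\<close> at
  \<open>f p\<close>, where the Rayleigh bound applies. Giving the factors explicitly avoids a
  spectral decomposition of \<open>B\<close>.\<close>

lemma gram_sum_le_lev:
  assumes V: "finite V" "V \<noteq> {}" "symmetric_on V A"
    and B: "\<And>i j. i \<in> V \<Longrightarrow> j \<in> V \<Longrightarrow> B i j = (\<Sum>p\<in>P. f p i * f p j)"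
  shows "(\<Sum>i\<in>V. \<Sum>j\<in>V. A i j * B i j) \<le> lev V A * (\<Sum>i\<in>V. B i i)"
proof -
  have "(\<Sum>i\<in>V. \<Sum>j\<in>V. A i j * B i j) = (\<Sum>i\<in>V. \<Sum>j\<in>V. \<Sum>p\<in>P. A i j * f p i * f p j)"
    using B by (simp add: sum_distrib_left mult.assoc)
  also have "\<dots> = (\<Sum>i\<in>V. \<Sum>p\<in>P. \<Sum>j\<in>V. A i j * f p i * f p j)"
    by (intro sum.cong refl sum.swap)
  also have "\<dots> = (\<Sum>p\<in>P. \<Sum>i\<in>V. \<Sum>j\<in>V. A i j * f p i * f p j)"
    by (rule sum.swap)
  also have "\<dots> \<le> (\<Sum>p\<in>P. lev V A * (\<Sum>i\<in>V. (f p i)\<^sup>2))"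
    by (intro sum_mono quadratic_form_le_lev[OF V])
  also have "\<dots> = lev V A * (\<Sum>p\<in>P. \<Sum>i\<in>V. (f p i)\<^sup>2)"
    by (simp add: sum_distrib_left)
  also have "(\<Sum>p\<in>P. \<Sum>i\<in>V. (f p i)\<^sup>2) = (\<Sum>i\<in>V. \<Sum>p\<in>P. (f p i)\<^sup>2)"
    by (rule sum.swap)
  also have "\<dots> = (\<Sum>i\<in>V. B i i)"
    using B by (simp add: power2_eq_square)
  finally show ?thesis .
qed

text \<open>\<open>B\<close> is a dual certificate: every admissible \<open>A\<close> is 1 wherever
  \<open>B\<close> may be nonzero, so the pairing of \<open>A\<close> with \<open>B\<close> is the
  entry sum of \<open>B\<close>, independent of \<open>A\<close>.\<close>

lemma lovasz_number_ge_gram: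
  assumes V: "finite V" "V \<noteq> {}"
    and B: "\<And>i j. i \<in> V \<Longrightarrow> j \<in> V \<Longrightarrow> B i j = (\<Sum>p\<in>P. f p i * f p j)"
    and edge: "\<And>i j. i \<in> V \<Longrightarrow> j \<in> V \<Longrightarrow> {i, j} \<in> E \<Longrightarrow> B i j = 0"
    and trace: "(\<Sum>i\<in>V. B i i) > 0"
  shows "(\<Sum>i\<in>V. \<Sum>j\<in>V. B i j) / (\<Sum>i\<in>V. B i i) \<le> lovasz_number V E"
  unfolding lovasz_number_def
proof (rule cINF_greatest)
  \<comment> \<open>A lower bound for an infimum of reals requires a nonempty index set; the
    all-ones matrix is admissible for every \<open>E\<close>.\<close>
  have "(\<lambda>_ _. 1) \<in> {A. symmetric_on V A \<and> (\<forall>i\<in>V. \<forall>j\<in>V. {i, j} \<notin> E \<longrightarrow> A i j = 1)}"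
    by (simp add: symmetric_on_def)
  then show "{A. symmetric_on V A \<and> (\<forall>i\<in>V. \<forall>j\<in>V. {i, j} \<notin> E \<longrightarrow> A i j = (1::real))} \<noteq> {}"
    by blast
next
  fix A assume "A \<in> {A. symmetric_on V A \<and> (\<forall>i\<in>V. \<forall>j\<in>V. {i, j} \<notin> E \<longrightarrow> A i j = (1::real))}"
  then have A: "symmetric_on V A" "\<And>i j. i \<in> V \<Longrightarrow> j \<in> V \<Longrightarrow> {i, j} \<notin> E \<Longrightarrow> A i j = 1"
    by auto
  have "(\<Sum>i\<in>V. \<Sum>j\<in>V. B i j) = (\<Sum>i\<in>V. \<Sum>j\<in>V. A i j * B i j)"
  proof (intro sum.cong refl)
    fix i j assume "i \<in> V" "j \<in> V"
    then show "B i j = A i j * B i j"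
      using A(2) edge by (cases "{i, j} \<in> E") auto
  qed
  also have "\<dots> \<le> lev V A * (\<Sum>i\<in>V. B i i)"
    using V A(1) B by (rule gram_sum_le_lev)
  finally show "(\<Sum>i\<in>V. \<Sum>j\<in>V. B i j) / (\<Sum>i\<in>V. B i i) \<le> lev V A"
    using trace by (simp add: divide_le_eq)
qed

section \<open>The intersection matrix\<close>

text \<open>Each of the two cross terms contributes \<open>- k^2 / n\<close> and the constant term
  \<open>k^2 / n\<close>, leaving a single \<open>- k^2 / n\<close>.\<close>

lemma card_Int_gram:
  fixes n :: nat
  assumes "n > 0" "A \<subseteq> {1..n}" "B \<subseteq> {1..n}" "card A = k" "card B = k"
  shows "(\<Sum>p=1..n. (of_bool (p \<in> A) - k / n) * (of_bool (p \<in> B) - k / n))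
    = real (card (A \<inter> B)) - (real k)\<^sup>2 / n"
proof -
  have c: "(\<Sum>p=1..n. of_bool (p \<in> C)) = real (card C)" if "C \<subseteq> {1..n}" for C
    using that by (simp add: Int_absorb1)
  have "(\<Sum>p=1..n. (of_bool (p \<in> A) - k / n) * (of_bool (p \<in> B) - k / n))
    = (\<Sum>p=1..n. of_bool (p \<in> A \<inter> B) - k / n * of_bool (p \<in> A) - k / n * of_bool (p \<in> B)
        + (k / n)\<^sup>2)"
    by (intro sum.cong refl) (auto simp: power2_eq_square algebra_simps)
  also have "\<dots> = real (card (A \<inter> B)) - k / n * card A - k / n * card B + n * (k / n)\<^sup>2"
    using assms(2,3) c[of A] c[of B] c[of "A \<inter> B"]
    by (simp only: sum.distrib sum_subtractf flip: sum_distrib_left) (simp add: le_infI1)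
  also have "\<dots> = real (card (A \<inter> B)) - (real k)\<^sup>2 / n"
    using assms by (simp add: field_simps power2_eq_square)
  finally show ?thesis .
qed

text \<open>Two applications of the absorption identity; this puts the target binomial on the scale
  of \<open>n choose k\<close>.\<close>

lemma choose_mult_absorb2:
  assumes "2 \<le> k" "k \<le> n"
  shows "k * (k - 1) * (n choose k) = n * (n - 1) * ((n - 2) choose (k - 2))"
proof -
  have "k * (n choose k) = n * ((n - 1) choose (k - 1))"
    using assms times_binomial_minus1_eq[of k n] by simp
  moreover have "(k - 1) * ((n - 1) choose (k - 1)) = (n - 1) * ((n - 2) choose (k - 2))"
    using assms times_binomial_minus1_eq[of "k - 1" "n - 1"] by (simp add: numeral_2_eq_2)
  ultimately show ?thesis by (metis mult.assoc mult.left_commute)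
qed

theorem theorem10:
  fixes n k :: nat
  assumes "k \<ge> 3"
    and "3 * k - 3 \<le> n"
    and "n < k\<^sup>2 - k + 1"
  shows "lovasz_number (G_verts n k) (G_edges n k 1) > real ((n - 2) choose (k - 2))"
proof -
  let ?V = "G_verts n k" and ?N = "real (n choose k)"
  define B where "B = (\<lambda>X Y :: nat set. real (card (X \<inter> Y)) - 1)"
  define u where "u = (\<lambda>(p :: nat) X. of_bool (p \<in> X) - real k / real n)"
  \<comment> \<open>Index 0 lies outside \<open>{1..n}\<close> and is free to carry the constant
    part of \<open>B\<close>; the radicand is positive because \<open>n < k^2\<close>.\<close>
  define f where "f = (\<lambda>p X. if p = 0 then sqrt ((real k)\<^sup>2 / n - 1) else u p X)"
  have kn: "k < n" "n > 0" using assms by auto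
  \<comment> \<open>This rules out truncation in the natural-number subtraction, so the upper bound
    on \<open>n\<close> transfers to the reals.\<close>
  have "k \<le> k\<^sup>2" by (simp add: power2_eq_square)
  then have "n < k\<^sup>2 + 1 - k" using assms(3) by simp
  then have nk: "real n < (real k)\<^sup>2 - k + 1"
    using \<open>k \<le> k\<^sup>2\<close> by (simp flip: of_nat_power)
  then have n_less: "real n < (real k)\<^sup>2" using assms(1) by linarith
  have V: "X \<subseteq> {1..n}" "finite X" "card X = k" if "X \<in> ?V" for X
    using that by (auto simp: G_verts_def nsets_def)
  have cardV: "card ?V = n choose k"
    by (simp add: G_verts_def)
  have N_pos: "?N > 0" using kn by simp
  have gram: "(\<Sum>p=1..n. u p X * u p Y) = real (card (X \<inter> Y)) - (real k)\<^sup>2 / n"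
    if "X \<in> ?V" "Y \<in> ?V" for X Y
    unfolding u_def using V that kn by (intro card_Int_gram) auto
  have "(\<Sum>X\<in>?V. \<Sum>Y\<in>?V. B X Y) / (\<Sum>X\<in>?V. B X X) \<le> lovasz_number ?V (G_edges n k 1)"
  proof (rule lovasz_number_ge_gram)
    show "finite ?V" "?V \<noteq> {}"
      using cardV N_pos card.empty card.infinite by fastforce+
    show "(\<Sum>X\<in>?V. B X X) > 0"
      using V(3) assms(1) N_pos by (simp add: B_def cardV)
    show "B X Y = (\<Sum>p\<in>insert 0 {1..n}. f p X * f p Y)" if "X \<in> ?V" "Y \<in> ?V" for X Y
    proof -
      have "(\<Sum>p\<in>insert 0 {1..n}. f p X * f p Y) = f 0 X * f 0 Y + (\<Sum>p=1..n. f p X * f p Y)"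
        by simp
      also have "(\<Sum>p=1..n. f p X * f p Y) = (\<Sum>p=1..n. u p X * u p Y)"
        by (intro sum.cong refl) (auto simp: f_def)
      also have "f 0 X * f 0 Y = (real k)\<^sup>2 / n - 1"
        using n_less kn by (simp add: f_def)
      finally show ?thesis using gram[OF that] by (simp add: B_def)
    qed
    show "B X Y = 0" if "{X, Y} \<in> G_edges n k 1" for X Y
      using that by (auto simp: G_edges_def B_def doubleton_eq_iff Int_commute)
  qed
  moreover have "(\<Sum>X\<in>?V. B X X) = ?N * (real k - 1)"
    using V(3) by (simp add: B_def cardV)
  \<comment> \<open>The centred part of \<open>B\<close> contributes a sum of squares, one for each
    point \<open>p\<close>. By symmetry these squares are in fact 0, but nonnegativity
    suffices.\<close>
  moreover have "?N\<^sup>2 * ((real k)\<^sup>2 / n - 1) \<le> (\<Sum>X\<in>?V. \<Sum>Y\<in>?V. B X Y)"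
  proof -
    have "0 \<le> (\<Sum>p=1..n. (\<Sum>X\<in>?V. u p X)\<^sup>2)"
      by (simp add: sum_nonneg)
    also have "\<dots> = (\<Sum>p=1..n. \<Sum>X\<in>?V. \<Sum>Y\<in>?V. u p X * u p Y)"
      by (simp add: power2_eq_square sum_product)
    also have "\<dots> = (\<Sum>X\<in>?V. \<Sum>p=1..n. \<Sum>Y\<in>?V. u p X * u p Y)"
      by (rule sum.swap)
    also have "\<dots> = (\<Sum>X\<in>?V. \<Sum>Y\<in>?V. \<Sum>p=1..n. u p X * u p Y)"
      by (intro sum.cong refl sum.swap)
    also have "\<dots> = (\<Sum>X\<in>?V. \<Sum>Y\<in>?V. B X Y - ((real k)\<^sup>2 / n - 1))"
      using gram by (simp add: B_def)
    also have "\<dots> = (\<Sum>X\<in>?V. \<Sum>Y\<in>?V. B X Y) - ?N\<^sup>2 * ((real k)\<^sup>2 / n - 1)"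
      by (simp add: sum_subtractf cardV power2_eq_square)
    finally show ?thesis by simp
  qed
  then have "?N\<^sup>2 * ((real k)\<^sup>2 / n - 1) / (?N * (real k - 1))
      \<le> (\<Sum>X\<in>?V. \<Sum>Y\<in>?V. B X Y) / (?N * (real k - 1))"
    using N_pos assms(1) by (intro divide_right_mono) auto
  moreover have "real ((n - 2) choose (k - 2)) < ?N\<^sup>2 * ((real k)\<^sup>2 / n - 1) / (?N * (real k - 1))"
  proof -
    let ?C = "real ((n - 2) choose (k - 2))"
    have "real (k * (k - 1) * (n choose k)) = real (n * (n - 1) * ((n - 2) choose (k - 2)))"
      using choose_mult_absorb2[of k n] assms(1) kn by simp
    then have C: "?C = ?N * (real k * (real k - 1)) / (real n * (real n - 1))"
      using kn assms(1) by (simp add: of_nat_diff field_simps)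
    \<comment> \<open>This factorisation is where the range of \<open>n\<close> enters: both factors
      are positive for \<open>k < n < k^2 - k + 1\<close>. Dividing the expanded form by
      \<open>n - 1\<close> and \<open>k - 1\<close> gives the strict comparison, up to the common
      factor \<open>?N / n\<close>.\<close>
    have "0 < (real n - k) * ((real k)\<^sup>2 - k + 1 - n)"
      using nk kn by simp
    also have "\<dots> = ((real k)\<^sup>2 - n) * (real n - 1) - real k * (real k - 1) * (real k - 1)"
      by (simp add: algebra_simps power2_eq_square)
    finally have "real k * (real k - 1) / (real n - 1) < ((real k)\<^sup>2 - n) / (real k - 1)"
      using kn assms(1) by (simp add: divide_less_eq less_divide_eq)
    then have "?N / n * (real k * (real k - 1) / (real n - 1)) < ?N / n * (((real k)\<^sup>2 - n) / (real k - 1))"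
      using N_pos kn by (intro mult_strict_left_mono) auto
    moreover have "?N\<^sup>2 * ((real k)\<^sup>2 / n - 1) / (?N * (real k - 1)) = ?N / n * (((real k)\<^sup>2 - n) / (real k - 1))"
      using N_pos kn assms(1) by (simp add: field_simps power2_eq_square)
    ultimately show ?thesis by (simp add: C)
  qed
  ultimately show ?thesis by simp
qed

end
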